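(* Let $\mathbb{F}$ be a field. Let $h$ and $m$ be positive integers with $h \leq m$. Let $A$ be a nonempty finite subset of $\mathbb{F}$ with $|A| = m$. Then $$|[0, h]_{\pm}^\wedge A| \geq \begin{cases} \min (p(\mathbb{F}), 2hm - h^2 - h|A \cap (- A)| + 1), & \text{if } 0 \in A;\\ \min (p(\mathbb{F}), 2hm - h^2 - h|A \cap (- A)| + h + 1), & \text{if } 0 \not\in A. \end{cases}$$
   Context: For a finite subset $A=\{a_1,\dots,a_m\}$ (with $|A|=m$) of $\mathbb{F}$ and a nonnegative integer $j$, the restricted $j$-fold signed sumset is $j_{\pm}^{\wedge}A=\{\sum_{i=1}^m\lambda_i a_i:\lambda_i\in\{-1,0,1\},\ \sum_{i=1}^m|\lambda_i|=j\}$, with $0_{\pm}^{\wedge}A=\{0\}$, and $[0,h]_{\pm}^{\wedge}A=\bigcup_{j=0}^{h}j_{\pm}^{\wedge}A$. Write $-A=\{-a:a\in A\}$. $p(\mathbb{F})$ denotes the order of the smallest nontrivial subgroup of the additive group of $\mathbb{F}$, or $\infty$ if there is no such finite subgroup; equivalently, the characteristic of $\mathbb{F}$ if it is positive and $\infty$ if the characteristic is $0$. *)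

theory Defs
  imports Complex_Main "HOL-Library.Extended_Real"
begin

definition restricted_signed_sumset :: "nat \<Rightarrow> 'a::ring_1 set \<Rightarrow> 'a set" where
  "restricted_signed_sumset j A =
     {\<Sum>a\<in>A. of_int (c a) * a | c :: 'a \<Rightarrow> int.
        (\<forall>a\<in>A. c a \<in> {-1, 0, 1}) \<and> (\<Sum>a\<in>A. \<bar>c a\<bar>) = int j}"

definition restricted_signed_sumset_upto :: "nat \<Rightarrow> 'a::ring_1 set \<Rightarrow> 'a set" where
  "restricted_signed_sumset_upto h A = (\<Union>j\<in>{0..h}. restricted_signed_sumset j A)"

definition additive_subgroup_of_type :: "'a::ab_group_add set \<Rightarrow> bool" where
  "additive_subgroup_of_type H \<longleftrightarrow>
     0 \<in> H \<and> (\<forall>x\<in>H. \<forall>y\<in>H. x + y \<in> H) \<and> (\<forall>x\<in>H. - x \<in> H)"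

(* The infimum is taken in enat, so it is infinite when no finite nontrivial subgroup exists;
   otherwise it is attained. *)
definition min_subgroup_order :: "'a::ab_group_add itself \<Rightarrow> enat" where
  "min_subgroup_order _ =
     (INF H \<in> {H :: 'a set. additive_subgroup_of_type H \<and> finite H \<and> H \<noteq> {0}}. enat (card H))"

end

theory Submission
  imports Defs "Jordan_Normal_Form.Determinant" "HOL-Library.FuncSet"
begin

text \<open>
Let \<open>B = A \<union> -A \<union> {0}\<close>. If \<open>S \<subseteq> B\<close> has \<open>h\<close> elements, then each nonzero element of \<open>S\<close> is \<open>a\<close> or \<open>-a\<close>
for some \<open>a \<in> A\<close>, a pair \<open>a, -a\<close> cancels, and \<open>0\<close> contributes nothing; so the sum of \<open>S\<close> is a
signed sum of at most \<open>h\<close> distinct elements of \<open>A\<close>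
(\<open>restricted_sumset_symmetrization_subset\<close>). Since \<open>card B\<close> is \<open>2 m - card (A \<inter> -A)\<close>, plus one
if \<open>0 \<notin> A\<close>, both cases of the theorem are the same bound
\<open>min p (h (card B - h) + 1)\<close> for the sums of \<open>h\<close> distinct elements of \<open>B\<close>. That bound is the
theorem of Dias da Silva and Hamidoune, \<open>dias_da_silva_hamidoune\<close>.

It is proved by the polynomial method of Alon, Nathanson and Ruzsa
(\<open>card_distinct_sums_gt\<close>). Let \<open>A\<^sub>0, ..., A\<^sub>h\<^sub>-\<^sub>1\<close> be finite sets with \<open>c\<^sub>i + 1\<close> elements, and let
\<open>C\<close> contain all sums \<open>x\<^sub>0 + ... + x\<^sub>h\<^sub>-\<^sub>1\<close> of distinct \<open>x\<^sub>i \<in> A\<^sub>i\<close>. Suppose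
that \<open>C\<close> has at most \<open>m = \<Sum> c\<^sub>i - \<Sum> i\<close> elements. The product of a monic univariate polynomial of
degree \<open>m\<close> that vanishes on \<open>C\<close>, evaluated at \<open>x\<^sub>0 + ... + x\<^sub>h\<^sub>-\<^sub>1\<close>, with the Vandermonde determinant
\<open>det (x\<^sub>i\<^sup>j)\<close> vanishes on the whole grid \<open>A\<^sub>0 \<times> ... \<times> A\<^sub>h\<^sub>-\<^sub>1\<close>: at repeated coordinates the determinant
is \<open>0\<close>, at distinct ones the other factor is. A function of total degree at most \<open>\<Sum> c\<^sub>i\<close> that
vanishes on the grid has no monomial \<open>\<Prod> x\<^sub>i^c\<^sub>i\<close>, because a linear combination of its values on the
grid gives that coefficient. Here this
coefficient comes from the leading term alone, and the one in
\<open>(x\<^sub>0 + ... + x\<^sub>h\<^sub>-\<^sub>1)\<^sup>m det (x\<^sub>i\<^sup>j)\<close>, multiplied by \<open>\<Prod> c\<^sub>i!\<close>, is \<open>m!\<close> times the determinant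
of the falling factorials \<open>c\<^sub>i (c\<^sub>i - 1) ... (c\<^sub>i - j + 1)\<close>, which is nonzero if the \<open>c\<^sub>i\<close> are distinct
in the field and \<open>m!\<close> is nonzero there. Hence \<open>C\<close> has more than \<open>m\<close> elements.
The numbers \<open>c\<^sub>i\<close> are then chosen so that none exceeds \<open>m\<close>, which makes them distinct in the field
whenever \<open>m\<close> is below the characteristic.
\<close>

section \<open>Reading off a top coefficient from values on a grid\<close>

text \<open>
The weights \<open>w\<close> define a linear functional on polynomials through their values on \<open>A\<close>; on
polynomials of degree at most \<open>n\<close> it is the coefficient of the \<open>n\<close>-th power.
\<close>
definition extracts_coeff :: "'a::field set \<Rightarrow> ('a \<Rightarrow> 'a) \<Rightarrow> nat \<Rightarrow> bool" where
  "extracts_coeff A w n \<longleftrightarrow>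
     (\<forall>k<n. (\<Sum>a\<in>A. w a * a ^ k) = 0) \<and> (\<Sum>a\<in>A. w a * a ^ n) = 1"

text \<open>
These are the Lagrange weights \<open>1 / \<Prod>\<^bsub>b \<noteq> a\<^esub> (a - b)\<close>. Adding a point \<open>b\<close> to the set divides the old
weights by \<open>a - b\<close>, so that the new moments satisfy \<open>M\<^sub>k\<^sub>+\<^sub>1 = b M\<^sub>k + (old moment k)\<close>. Starting
from \<open>M\<^sub>0 = 0\<close>, this shifts the required moments up by one index.
\<close>
lemma exists_extracts_coeff:
  fixes A :: "'a::field set"
  assumes "finite A" "A \<noteq> {}" "card A = Suc n"
  shows "\<exists>w. extracts_coeff A w n"
  using assms
proof (induction A arbitrary: n rule: finite_ne_induct)
  case (singleton b)
  then show ?case by (auto simp: extracts_coeff_def)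
next
  case (insert b A)
  then obtain n' where n': "n = Suc n'" "card A = Suc n'"
    by (metis card_eq_0_iff card_insert_disjoint nat.inject not0_implies_Suc)
  with insert.IH obtain w where w: "extracts_coeff A w n'" by blast
  define u where "u a = w a / (a - b)" for a
  \<comment> \<open>The weight of the new point is dictated by the vanishing of the moment \<open>M 0\<close>.\<close>
  define v where "v a = (if a = b then - (\<Sum>a\<in>A. u a) else u a)" for a
  define M where "M k = (\<Sum>a\<in>insert b A. v a * a ^ k)" for k
  have vA: "(\<Sum>a\<in>A. v a * f a) = (\<Sum>a\<in>A. u a * f a)" for f
    by (rule sum.cong) (use insert in \<open>auto simp: v_def\<close>)
  have M0: "M 0 = 0"
    using insert.hyps vA[of "\<lambda>_. 1"] by (simp add: M_def v_def)
  have step: "M (Suc k) = b * M k + (\<Sum>a\<in>A. w a * a ^ k)" for k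
  proof -
    have "M (Suc k) - b * M k = (\<Sum>a\<in>insert b A. v a * a ^ k * (a - b))"
      by (simp add: M_def sum_distrib_left algebra_simps flip: sum_subtractf)
    also have "\<dots> = (\<Sum>a\<in>A. v a * (a ^ k * (a - b)))"
      using insert.hyps by (simp add: mult.assoc)
    also have "\<dots> = (\<Sum>a\<in>A. u a * (a ^ k * (a - b)))" by (rule vA)
    also have "\<dots> = (\<Sum>a\<in>A. w a * a ^ k)"
      by (rule sum.cong) (use insert.hyps in \<open>auto simp: u_def\<close>)
    finally show ?thesis by (simp add: algebra_simps)
  qed
  have "k \<le> n' \<Longrightarrow> M k = 0" for k
    using w by (induction k) (auto simp: M0 step extracts_coeff_def)
  moreover from this[of n'] have "M (Suc n') = 1"
    using w by (simp add: step extracts_coeff_def)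
  ultimately have "extracts_coeff (insert b A) v n"
    unfolding extracts_coeff_def n' M_def by (simp del: power_Suc)
  then show ?case by blast
qed

text \<open>
The tensor product of the one-variable functionals. It acts on functions of \<open>h\<close> variables, which
stand for the polynomials they are given by.
\<close>
definition grid_functional ::
    "nat \<Rightarrow> (nat \<Rightarrow> 'a set) \<Rightarrow> (nat \<Rightarrow> 'a \<Rightarrow> 'a) \<Rightarrow> ((nat \<Rightarrow> 'a) \<Rightarrow> 'a) \<Rightarrow> 'a::field" where
  "grid_functional h A w g = (\<Sum>x\<in>PiE {..<h} A. (\<Prod>i<h. w i (x i)) * g x)"

lemma grid_functional_sum:
  "grid_functional h A w (\<lambda>x. \<Sum>j\<in>J. g j x) = (\<Sum>j\<in>J. grid_functional h A w (g j))"
  unfolding grid_functional_def by (simp add: sum_distrib_left sum.swap[of _ J])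

lemma grid_functional_cmult:
  "grid_functional h A w (\<lambda>x. r * g x) = r * grid_functional h A w g"
  unfolding grid_functional_def by (simp add: sum_distrib_left mult.left_commute)

lemma grid_functional_monomial:
  assumes "\<And>i. i < h \<Longrightarrow> finite (A i)"
  shows "grid_functional h A w (\<lambda>x. \<Prod>i<h. x i ^ d i) = (\<Prod>i<h. \<Sum>a\<in>A i. w i a * a ^ d i)"
  using assms by (subst prod_sum_PiE) (auto simp: grid_functional_def prod.distrib)

definition falling :: "'a::comm_ring_1 \<Rightarrow> nat \<Rightarrow> 'a" where
  "falling x d = (\<Prod>j<d. x - of_nat j)"

lemma falling_Suc: "falling x (Suc d) = falling x d * (x - of_nat d)"
  by (simp add: falling_def)

lemma falling_of_nat_eq_0: "c < d \<Longrightarrow> falling (of_nat c) d = 0"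
  by (auto simp: falling_def intro!: prod_zero bexI[of _ c])

lemma prod_fun_upd_Suc:
  fixes f :: "nat \<Rightarrow> nat \<Rightarrow> 'a::comm_monoid_mult"
  assumes "j < h" "f j (Suc (d j)) = f j (d j) * r"
  shows "(\<Prod>i<h. f i ((d(j := Suc (d j))) i)) = (\<Prod>i<h. f i (d i)) * r"
proof -
  have "j \<in> {..<h}" using assms by simp
  then show ?thesis
    by (simp add: prod.remove[of _ j] assms mult_ac cong: prod.cong_simp)
qed

lemma sum_fun_upd_Suc:
  fixes d :: "nat \<Rightarrow> nat"
  assumes "j < h"
  shows "(\<Sum>i<h. (d(j := Suc (d j))) i) = Suc (\<Sum>i<h. d i)"
proof -
  have "(\<Sum>i<h. (d(j := Suc (d j))) i) = (\<Sum>i<h. d i + (if i = j then 1 else 0))"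
    by (rule sum.cong) auto
  also have "\<dots> = (\<Sum>i<h. d i) + (\<Sum>i<h. if i = j then 1 else 0)"
    by (rule sum.distrib)
  also have "(\<Sum>i<h. if i = j then 1 else 0 :: nat) = 1"
    using assms by (subst sum.delta) simp_all
  finally show ?thesis by simp
qed

text \<open>
For \<open>d\<^sub>i \<le> c\<^sub>i\<close> and equal degrees the multinomial theorem gives the coefficient of \<open>\<Prod> x\<^sub>i^c\<^sub>i\<close> in
\<open>(\<Sum> x\<^sub>i)\<^sup>s \<Prod> x\<^sub>i^d\<^sub>i\<close> as \<open>s! / \<Prod> (c\<^sub>i - d\<^sub>i)!\<close>. Multiplying by \<open>\<Prod> c\<^sub>i!\<close>, which is the first factor on
the left, turns this into \<open>s!\<close> times a product of falling factorials. This form holds in every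
characteristic and, as falling factorials vanish for \<open>d\<^sub>i > c\<^sub>i\<close>, for all exponents, so it follows
by induction on \<open>s\<close> from expanding one factor \<open>\<Sum> x\<^sub>i\<close>: the terms carry the factors
\<open>c\<^sub>i - d\<^sub>i\<close>, whose sum is the exponent of \<open>\<Sum> x\<^sub>i\<close>. In smaller total degree every monomial
falls short of some \<open>c\<^sub>i\<close> and the functional vanishes.
\<close>
lemma grid_functional_power_monomial:
  fixes c d :: "nat \<Rightarrow> nat"
  assumes fin: "\<And>i. i < h \<Longrightarrow> finite (A i)"
    and ext: "\<And>i. i < h \<Longrightarrow> extracts_coeff (A i) (w i) (c i)"
    and le: "s + (\<Sum>i<h. d i) \<le> (\<Sum>i<h. c i)"
  shows "(\<Prod>i<h. falling (of_nat (c i)) (c i)) *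
           grid_functional h A w (\<lambda>x. (\<Sum>i<h. x i) ^ s * (\<Prod>i<h. x i ^ d i)) =
         (if s + (\<Sum>i<h. d i) = (\<Sum>i<h. c i)
          then of_nat (fact s) * (\<Prod>i<h. falling (of_nat (c i)) (d i)) else 0)"
  using le
proof (induction s arbitrary: d)
  case 0
  have Lam: "grid_functional h A w (\<lambda>x. (\<Sum>i<h. x i) ^ 0 * (\<Prod>i<h. x i ^ d i)) =
      (\<Prod>i<h. \<Sum>a\<in>A i. w i a * a ^ d i)"
    using grid_functional_monomial[OF fin] by simp
  show ?case
  proof (cases "\<forall>i<h. d i = c i")
    case True
    then show ?thesis unfolding Lam using ext by (simp add: extracts_coeff_def)
  next
    case False
    \<comment> \<open>Different exponents of no larger total degree fall short of \<open>c\<close> somewhere, where the functional is 0.\<close>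
    have "\<exists>i<h. d i < c i"
    proof (rule ccontr)
      assume "\<not> (\<exists>i<h. d i < c i)"
      then have "\<forall>i\<in>{..<h}. c i \<le> d i" by (meson lessThan_iff not_less)
      moreover have "\<exists>i\<in>{..<h}. c i < d i" using False calculation by force
      ultimately have "(\<Sum>i<h. c i) < (\<Sum>i<h. d i)" by (intro sum_strict_mono_ex1) auto
      with 0 show False by simp
    qed
    then have "(\<Prod>i<h. \<Sum>a\<in>A i. w i a * a ^ d i) = 0"
      using ext by (force simp: extracts_coeff_def)
    moreover have "(\<Prod>i<h. falling (of_nat (c i)) (d i) :: 'a) = 0"
      if eq: "(\<Sum>i<h. d i) = (\<Sum>i<h. c i)"
    proof -
      have "\<exists>i<h. c i < d i"
      proof (rule ccontr)
        assume "\<not> (\<exists>i<h. c i < d i)"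
        then have "\<forall>i\<in>{..<h}. d i \<le> c i" by (meson lessThan_iff not_less)
        moreover have "\<exists>i\<in>{..<h}. d i < c i" using False calculation by force
        ultimately have "(\<Sum>i<h. d i) < (\<Sum>i<h. c i)" by (intro sum_strict_mono_ex1) auto
        with eq show False by simp
      qed
      then show ?thesis by (force simp: falling_of_nat_eq_0)
    qed
    ultimately show ?thesis unfolding Lam by (simp del: prod_zero_iff)
  qed
next
  case (Suc s)
  let ?P = "\<Prod>i<h. falling (of_nat (c i)) (c i) :: 'a"
  let ?D = "\<lambda>j. d(j := Suc (d j))"
  let ?F = "\<Prod>i<h. falling (of_nat (c i)) (d i) :: 'a"
  have sumD: "s + (\<Sum>i<h. ?D j i) = Suc s + (\<Sum>i<h. d i)" if "j < h" for j
    using sum_fun_upd_Suc[OF that, of d] by linarith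
  have "(\<Sum>i<h. x i) ^ Suc s * (\<Prod>i<h. x i ^ d i) =
      (\<Sum>j<h. (\<Sum>i<h. x i) ^ s * (\<Prod>i<h. x i ^ ?D j i))" for x :: "nat \<Rightarrow> 'a"
  proof -
    have "(\<Sum>j<h. (\<Sum>i<h. x i) ^ s * (\<Prod>i<h. x i ^ ?D j i)) =
        (\<Sum>j<h. (\<Sum>i<h. x i) ^ s * ((\<Prod>i<h. x i ^ d i) * x j))"
      by (intro sum.cong refl arg_cong2[of _ _ _ _ "(*)"] prod_fun_upd_Suc[of _ h "\<lambda>i e. x i ^ e"])
        auto
    also have "\<dots> = (\<Sum>i<h. x i) ^ s * (\<Prod>i<h. x i ^ d i) * (\<Sum>j<h. x j)"
      by (simp only: sum_distrib_left mult.assoc)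
    finally show ?thesis by (simp add: mult_ac)
  qed
  then have "?P * grid_functional h A w (\<lambda>x. (\<Sum>i<h. x i) ^ Suc s * (\<Prod>i<h. x i ^ d i)) =
      (\<Sum>j<h. ?P * grid_functional h A w (\<lambda>x. (\<Sum>i<h. x i) ^ s * (\<Prod>i<h. x i ^ ?D j i)))"
    by (simp only: grid_functional_sum sum_distrib_left)
  also have "\<dots> = (\<Sum>j<h. if Suc s + (\<Sum>i<h. d i) = (\<Sum>i<h. c i)
      then of_nat (fact s) * (\<Prod>i<h. falling (of_nat (c i)) (?D j i)) else 0)"
    using sumD Suc.prems by (intro sum.cong refl) (subst Suc.IH, auto)
  also have "\<dots> = (if Suc s + (\<Sum>i<h. d i) = (\<Sum>i<h. c i)
      then of_nat (fact (Suc s)) * ?F else 0)"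
  proof (cases "Suc s + (\<Sum>i<h. d i) = (\<Sum>i<h. c i)")
    case True
    have "(\<Prod>i<h. falling (of_nat (c i)) (?D j i)) = ?F * (of_nat (c j) - of_nat (d j))"
      if "j < h" for j
      using that by (intro prod_fun_upd_Suc[of _ h "\<lambda>i e. falling (of_nat (c i)) e"])
        (simp_all add: falling_Suc)
    then have "(\<Sum>j<h. of_nat (fact s) * (\<Prod>i<h. falling (of_nat (c i)) (?D j i))) =
        (\<Sum>j<h. of_nat (fact s) * (?F * (of_nat (c j) - of_nat (d j))))"
      by (intro sum.cong) auto
    also have "\<dots> = of_nat (fact s) * ?F * (\<Sum>j<h. of_nat (c j) - of_nat (d j))"
      by (simp add: sum_distrib_left mult.assoc)
    also have "(\<Sum>j<h. of_nat (c j) - of_nat (d j)) = (of_nat (Suc s) :: 'a)"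
      by (simp add: sum_subtractf flip: of_nat_sum True)
    finally show ?thesis using True by (simp add: algebra_simps del: prod_zero_iff)
  qed auto
  finally show ?case .
qed

section \<open>Determinants of polynomial values\<close>

text \<open>
A vector in the kernel gives a combination of the \<open>P\<^sub>j\<close> of degree less than \<open>n\<close> with \<open>n\<close> roots;
it is \<open>0\<close>, and as the degrees are distinct, so are its coefficients.
\<close>
lemma det_graded_basis_nonzero:
  fixes P :: "nat \<Rightarrow> 'a::field poly" and y :: "nat \<Rightarrow> 'a"
  assumes inj: "inj_on y {..<n}" and deg: "\<And>j. j < n \<Longrightarrow> degree (P j) = j \<and> P j \<noteq> 0"
  shows "det (mat n n (\<lambda>(i, j). poly (P j) (y i))) \<noteq> 0"
proof
  let ?M = "mat n n (\<lambda>(i, j). poly (P j) (y i))"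
  assume "det ?M = 0"
  then obtain v where v: "v \<in> carrier_vec n" "v \<noteq> 0\<^sub>v n" "?M *\<^sub>v v = 0\<^sub>v n"
    by (subst (asm) det_0_iff_vec_prod_zero[of _ n]) auto
  define q where "q = (\<Sum>j<n. smult (v $ j) (P j))"
  have root: "poly q (y i) = 0" if "i < n" for i
  proof -
    have "0 = (?M *\<^sub>v v) $ i" using v that by simp
    also have "\<dots> = poly q (y i)"
      using that v(1)
      by (simp add: q_def poly_sum scalar_prod_def lessThan_atLeast0 mult.commute)
    finally show ?thesis by simp
  qed
  define J where "J = {j. j < n \<and> v $ j \<noteq> 0}"
  have "J \<noteq> {}" using v by (auto simp: J_def vec_eq_iff)
  moreover have "finite J" by (simp add: J_def)
  ultimately have Max: "Max J \<in> J" "\<And>j. j \<in> J \<Longrightarrow> j \<le> Max J" by auto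
  have degq: "degree q < n"
    using Max deg unfolding q_def J_def
    by (intro degree_sum_less) (auto simp: J_def intro: le_less_trans[OF degree_smult_le])
  have "coeff q (Max J) = (\<Sum>j<n. if j = Max J then v $ j * coeff (P j) j else 0)"
    unfolding q_def coeff_sum
  proof (rule sum.cong)
    fix j assume j: "j \<in> {..<n}"
    show "coeff (smult (v $ j) (P j)) (Max J) = (if j = Max J then v $ j * coeff (P j) j else 0)"
    proof (cases "v $ j = 0 \<or> j = Max J")
      case False
      with j have "j \<in> J" by (simp add: J_def)
      then have "j < Max J" using Max(2)[of j] False by simp
      then show ?thesis using deg[of j] j by (simp add: coeff_eq_0)
    qed auto
  qed simp
  also have "\<dots> \<noteq> 0"
    using Max(1) deg[of "Max J"] by (auto simp: J_def leading_coeff_0_iff[symmetric] simp del: leading_coeff_0_iff)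
  finally have "q \<noteq> 0" by auto
  have "card (y ` {..<n}) \<le> card {x. poly q x = 0}"
    using root poly_roots_finite[OF \<open>q \<noteq> 0\<close>] by (intro card_mono) auto
  also have "\<dots> \<le> degree q" by (rule card_poly_roots_bound) fact
  finally show False using degq inj by (simp add: card_image)
qed

lemma det_falling_nonzero:
  fixes y :: "nat \<Rightarrow> 'a::field"
  assumes "inj_on y {..<n}"
  shows "det (mat n n (\<lambda>(i, j). falling (y i) j)) \<noteq> 0"
proof -
  define P :: "nat \<Rightarrow> 'a poly" where "P j = (\<Prod>k<j. [:- of_nat k, 1:])" for j
  have "degree (P j) = j" "P j \<noteq> 0" for j
    by (auto simp: P_def degree_prod_eq_sum_degree)
  moreover have "poly (P j) x = falling x j" for j x
    by (simp add: P_def falling_def poly_prod)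
  ultimately show ?thesis using det_graded_basis_nonzero[OF assms, of P] by simp
qed

definition vandermonde :: "nat \<Rightarrow> (nat \<Rightarrow> 'a) \<Rightarrow> 'a::field" where
  "vandermonde h x = det (mat h h (\<lambda>(i, j). x i ^ j))"

lemma vandermonde_eq_0:
  assumes "\<not> inj_on x {..<h}"
  shows "vandermonde h x = 0"
proof -
  from assms obtain i j where "i < h" "j < h" "i \<noteq> j" "x i = x j" by (auto simp: inj_on_def)
  then show ?thesis unfolding vandermonde_def
    by (intro det_identical_rows[of _ h i j]) (auto simp: vec_eq_iff)
qed

lemma det_mat_lessThan:
  "det (mat h h f) = (\<Sum>p | p permutes {..<h}. of_int (sign p) * (\<Prod>i<h. f (i, p i)))"
  unfolding det_def by (auto simp: lessThan_atLeast0 permutes_def intro!: sum.cong prod.cong arg_cong2[of _ _ _ _ "(*)"])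

text \<open>
Expanding the determinant over permutations reduces this to monomials whose exponents are a
permutation of \<open>0, ..., h - 1\<close>; the resulting falling factorials reassemble to a determinant.
\<close>
lemma grid_functional_power_vandermonde:
  fixes c :: "nat \<Rightarrow> nat" and w :: "nat \<Rightarrow> 'a::field \<Rightarrow> 'a"
  assumes fin: "\<And>i. i < h \<Longrightarrow> finite (A i)"
    and ext: "\<And>i. i < h \<Longrightarrow> extracts_coeff (A i) (w i) (c i)"
    and le: "s + (\<Sum>i<h. i) \<le> (\<Sum>i<h. c i)"
  shows "(\<Prod>i<h. falling (of_nat (c i)) (c i)) *
           grid_functional h A w (\<lambda>x. (\<Sum>i<h. x i) ^ s * vandermonde h x) =
         (if s + (\<Sum>i<h. i) = (\<Sum>i<h. c i)
          then of_nat (fact s) * det (mat h h (\<lambda>(i, j). falling (of_nat (c i)) j)) else 0)"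
proof -
  let ?P = "\<Prod>i<h. falling (of_nat (c i)) (c i) :: 'a"
  let ?Per = "{p. p permutes {..<h}}"
  have "(\<Sum>i<h. x i) ^ s * vandermonde h x =
     (\<Sum>p\<in>?Per. of_int (sign p) * ((\<Sum>i<h. x i) ^ s * (\<Prod>i<h. x i ^ p i)))" for x :: "nat \<Rightarrow> 'a"
    by (simp add: vandermonde_def det_mat_lessThan sum_distrib_left mult_ac)
  then have "?P * grid_functional h A w (\<lambda>x. (\<Sum>i<h. x i) ^ s * vandermonde h x) =
      (\<Sum>p\<in>?Per. of_int (sign p) *
         (?P * grid_functional h A w (\<lambda>x. (\<Sum>i<h. x i) ^ s * (\<Prod>i<h. x i ^ p i))))"
    by (simp add: grid_functional_sum grid_functional_cmult sum_distrib_left mult.left_commute)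
  also have "\<dots> = (\<Sum>p\<in>?Per. of_int (sign p) *
      (if s + (\<Sum>i<h. i) = (\<Sum>i<h. c i)
       then of_nat (fact s) * (\<Prod>i<h. falling (of_nat (c i)) (p i)) else 0))"
  proof (rule sum.cong[OF refl])
    fix p assume "p \<in> ?Per"
    then have "(\<Sum>i<h. p i) = (\<Sum>i<h. i)"
      using sum.permute[of p "{..<h}" "\<lambda>i. i"] by (simp add: o_def)
    then show "of_int (sign p) * (?P * grid_functional h A w
        (\<lambda>x. (\<Sum>i<h. x i) ^ s * (\<Prod>i<h. x i ^ p i))) = of_int (sign p) *
      (if s + (\<Sum>i<h. i) = (\<Sum>i<h. c i)
       then of_nat (fact s) * (\<Prod>i<h. falling (of_nat (c i)) (p i)) else 0)"
      using le by (subst grid_functional_power_monomial[OF fin ext]) simp_all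
  qed
  also have "\<dots> = (if s + (\<Sum>i<h. i) = (\<Sum>i<h. c i)
          then of_nat (fact s) * det (mat h h (\<lambda>(i, j). falling (of_nat (c i)) j)) else 0)"
    by (auto simp: det_mat_lessThan sum_distrib_left mult_ac)
  finally show ?thesis .
qed

section \<open>Sums of distinct elements\<close>

text \<open>
If \<open>C\<close> had at most \<open>m\<close> elements, a monic polynomial \<open>g\<close> of degree exactly \<open>m\<close> would vanish on \<open>C\<close>,
and \<open>g (\<Sum> x\<^sub>i) det (x\<^sub>i\<^sup>j)\<close> would vanish on the grid. Its terms of lower degree do not reach the monomial
\<open>\<Prod> x\<^sub>i^c\<^sub>i\<close>, so the coefficient there would be the nonzero one of \<open>(\<Sum> x\<^sub>i)\<^sup>m det (x\<^sub>i\<^sup>j)\<close>.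
\<close>
lemma card_distinct_sums_gt:
  fixes A :: "nat \<Rightarrow> 'a::field set" and c :: "nat \<Rightarrow> nat"
  assumes fin: "\<And>i. i < h \<Longrightarrow> finite (A i)"
    and card: "\<And>i. i < h \<Longrightarrow> card (A i) = Suc (c i)"
    and inj: "inj_on (\<lambda>i. of_nat (c i) :: 'a) {..<h}"
    and sum: "m + (\<Sum>i<h. i) = (\<Sum>i<h. c i)"
    and fact: "of_nat (fact m) \<noteq> (0 :: 'a)"
    and C: "finite C" "\<And>x. x \<in> PiE {..<h} A \<Longrightarrow> inj_on x {..<h} \<Longrightarrow> (\<Sum>i<h. x i) \<in> C"
  shows "m < card C"
proof (rule ccontr)
  assume "\<not> m < card C"
  then have cardC: "card C \<le> m" by simp
  have "\<forall>i<h. \<exists>w. extracts_coeff (A i) w (c i)"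
    using fin card by (metis card.empty exists_extracts_coeff nat.distinct(1))
  then obtain w where w: "\<And>i. i < h \<Longrightarrow> extracts_coeff (A i) (w i) (c i)" by metis
  let ?P = "\<Prod>i<h. falling (of_nat (c i)) (c i) :: 'a"
  let ?L = "grid_functional h A w"
  \<comment> \<open>The power of the variable raises the degree to exactly \<open>m\<close>.\<close>
  define g where "g = (\<Prod>r\<in>C. [:- r, 1:]) * monom 1 (m - card C)"
  have "degree g = degree (\<Prod>r\<in>C. [:- r, 1:]) + degree (monom (1 :: 'a) (m - card C))"
    unfolding g_def by (intro degree_mult_eq) (auto simp: C(1))
  also have "degree (\<Prod>r\<in>C. [:- r, 1:]) = card C"
    by (subst degree_prod_eq_sum_degree) simp_all
  also have "degree (monom (1 :: 'a) (m - card C)) = m - card C"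
    by (intro degree_monom_eq) simp
  finally have degg: "degree g = m"
    using cardC by simp
  have "lead_coeff g = 1"
    unfolding g_def lead_coeff_mult lead_coeff_prod lead_coeff_monom by simp
  then have lead: "coeff g m = 1" by (simp only: degg)
  have "poly g (\<Sum>i<h. x i) * vandermonde h x = 0" if "x \<in> PiE {..<h} A" for x
  proof (cases "inj_on x {..<h}")
    case True
    then have "poly g (\<Sum>i<h. x i) = 0"
      using C that by (auto simp: g_def poly_prod intro!: prod_zero)
    then show ?thesis by simp
  qed (simp add: vandermonde_eq_0)
  then have "?L (\<lambda>x. poly g (\<Sum>i<h. x i) * vandermonde h x) = 0"
    unfolding grid_functional_def by (intro sum.neutral ballI) (simp only: mult_zero_right)
  moreover have "?P * ?L (\<lambda>x. poly g (\<Sum>i<h. x i) * vandermonde h x) =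
      of_nat (fact m) * det (mat h h (\<lambda>(i, j). falling (of_nat (c i)) j))"
  proof -
    have "poly g (\<Sum>i<h. x i) * vandermonde h x =
        (\<Sum>k\<le>m. coeff g k * ((\<Sum>i<h. x i) ^ k * vandermonde h x))" for x
      by (simp add: poly_altdef degg sum_distrib_right mult.assoc)
    then have "?P * ?L (\<lambda>x. poly g (\<Sum>i<h. x i) * vandermonde h x) =
        (\<Sum>k\<le>m. coeff g k * (?P * ?L (\<lambda>x. (\<Sum>i<h. x i) ^ k * vandermonde h x)))"
      by (simp add: grid_functional_sum grid_functional_cmult sum_distrib_left mult.left_commute)
    also have "\<dots> = (\<Sum>k\<le>m. if k = m
        then of_nat (fact m) * det (mat h h (\<lambda>(i, j). falling (of_nat (c i)) j)) else 0)"
      using sum lead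
      by (intro sum.cong refl) (subst grid_functional_power_vandermonde[OF fin w], auto)
    finally show ?thesis by simp
  qed
  ultimately show False using fact det_falling_nonzero[OF inj] by simp
qed

definition restricted_sumset :: "nat \<Rightarrow> 'a::comm_monoid_add set \<Rightarrow> 'a set" where
  "restricted_sumset h A = Sum ` {S. S \<subseteq> A \<and> card S = h}"

lemma finite_restricted_sumset:
  assumes "finite A"
  shows "finite (restricted_sumset h A)"
proof -
  have "restricted_sumset h A \<subseteq> Sum ` Pow A" by (auto simp: restricted_sumset_def)
  then show ?thesis using assms by (meson finite_Pow_iff finite_imageI finite_subset)
qed

lemma restricted_sumset_nonempty:
  assumes "h \<le> card A"
  shows "restricted_sumset h A \<noteq> {}"
  using obtain_subset_with_card_n[OF assms] by (force simp: restricted_sumset_def)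

text \<open>
The obvious sizes \<open>c\<^sub>i = k + i\<close> yield \<open>h * k\<close>, but if \<open>m\<close> is smaller they may be too large to be
distinct in the field. Therefore all but \<open>h'\<close> of the summands are fixed, where \<open>h'\<close> is least with
\<open>m \<le> h' * k\<close>, and \<open>c\<^sub>0\<close> is lowered until the sum matches \<open>m\<close>. Minimality of \<open>h'\<close> then gives
\<open>c\<^sub>i \<le> m\<close>, and differences of the \<open>c\<^sub>i\<close> are nonzero in the field because they divide \<open>m!\<close>.
\<close>
lemma card_restricted_sumset_gt:
  fixes A :: "'a::field set"
  assumes fin: "finite A" and card: "card A = h + k" and mhk: "m \<le> h * k"
    and fact: "of_nat (fact m) \<noteq> (0 :: 'a)"
  shows "m < card (restricted_sumset h A)"
proof (cases "m = 0")
  case True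
  then show ?thesis
    using finite_restricted_sumset[OF fin, of h] restricted_sumset_nonempty[of h A] card
    by (simp add: card_gt_0_iff)
next
  case False
  then have k: "k > 0" using mhk by (cases k) auto
  define h' where "h' = (LEAST l. m \<le> l * k)"
  have h': "m \<le> h' * k" "h' \<le> h"
    unfolding h'_def using mhk by (auto intro: LeastI Least_le)
  obtain q where q: "h' = Suc q" using h'(1) False by (cases h') auto
  have qk: "q * k < m"
    using not_less_Least[of q "\<lambda>l. m \<le> l * k"] q by (simp flip: h'_def)
  define c where "c i = (if i = 0 then m - q * k else k + i)" for i
  have c_le: "c i \<le> k + q" if "i < h'" for i
    using that h'(1) by (auto simp: c_def q)
  have c_le_m: "c i \<le> m" if "i < h'" for i
  proof (cases "i = 0")
    case False
    then have "q > 0" using that q by simp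
    then obtain q' k' where "q = Suc q'" "k = Suc k'"
      using k by (meson gr0_implies_Suc)
    \<comment> \<open>This is \<open>(q - 1) (k - 1) \<ge> 0\<close>.\<close>
    then have "k + q \<le> Suc (q * k)" by simp
    then show ?thesis using c_le[OF that] qk by simp
  qed (simp add: c_def)
  have c_mono: "c i < c j" if "i < j" "j < h'" for i j
    using that h'(1) by (auto simp: c_def q)
  have nonzero: "of_nat j \<noteq> (0 :: 'a)" if "0 < j" "j \<le> m" for j
  proof -
    have "j dvd fact m" using that by (intro dvd_fact) auto
    then show ?thesis using fact by auto
  qed
  have "of_nat (c i) \<noteq> (of_nat (c j) :: 'a)" if "i < j" "j < h'" for i j
  proof -
    have "c i < c j" "c j - c i \<le> m" using c_mono[OF that] c_le_m[OF that(2)] by simp_all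
    then show ?thesis using nonzero[of "c j - c i"] by auto
  qed
  then have inj: "inj_on (\<lambda>i. of_nat (c i) :: 'a) {..<h'}"
    by (metis (mono_tags, lifting) inj_onI lessThan_iff linorder_neqE_nat)
  have sum: "m + (\<Sum>i<h'. i) = (\<Sum>i<h'. c i)"
  proof -
    have "(\<Sum>i<q. k + Suc i) = q * k + (\<Sum>i<q. Suc i)"
      by (simp only: sum.distrib sum_constant card_lessThan of_nat_id)
    then show ?thesis using qk unfolding q sum.lessThan_Suc_shift by (simp add: c_def)
  qed
  obtain A' where A': "A' \<subseteq> A" "card A' = h' + k" "finite A'"
    using obtain_subset_with_card_n[of "h' + k" A] h'(2) card by auto
  \<comment> \<open>The elements of \<open>D\<close> are the fixed summands.\<close>
  define D where "D = A - A'"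
  have D: "finite D" "D \<inter> A' = {}" "card D = h - h'"
    using A' fin card by (auto simp: D_def card_Diff_subset)
  have "\<exists>T. T \<subseteq> A' \<and> card T = Suc (c i)" if "i < h'" for i
    using obtain_subset_with_card_n[of "Suc (c i)" A'] c_le[OF that] A'(2) q by auto
  then obtain T where T: "\<And>i. i < h' \<Longrightarrow> T i \<subseteq> A' \<and> card (T i) = Suc (c i)" by metis
  define C where "C = (\<lambda>s. s - \<Sum>D) ` restricted_sumset h A"
  have "m < card C"
  proof (rule card_distinct_sums_gt[where A = T, OF _ _ inj sum fact])
    show "finite C" using finite_restricted_sumset[OF fin] by (simp add: C_def)
    show "finite (T i)" "card (T i) = Suc (c i)" if "i < h'" for i
      using T[OF that] A'(3) by (auto intro: finite_subset)
    fix x assume x: "x \<in> PiE {..<h'} T" "inj_on x {..<h'}"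
    let ?X = "x ` {..<h'}"
    have X: "?X \<subseteq> A'" using x(1) T by fastforce
    then have "?X \<inter> D = {}" using D by auto
    then have "\<Sum>(?X \<union> D) = (\<Sum>i<h'. x i) + \<Sum>D" "card (?X \<union> D) = h"
      using x(2) D(1,3) h'(2) by (simp_all add: sum.union_disjoint card_Un_disjoint sum.reindex card_image)
    moreover have "?X \<union> D \<subseteq> A" using X A'(1) by (auto simp: D_def)
    ultimately have "(\<Sum>i<h'. x i) + \<Sum>D \<in> restricted_sumset h A"
      unfolding restricted_sumset_def by (intro image_eqI[of _ _ "?X \<union> D"]) simp_all
    then show "(\<Sum>i<h'. x i) \<in> C" unfolding C_def by (rule rev_image_eqI) simp
  qed
  also have "card C \<le> card (restricted_sumset h A)"
    unfolding C_def using finite_restricted_sumset[OF fin] by (rule card_image_le)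
  finally show ?thesis .
qed

lemma of_nat_fact_nonzero:
  assumes "CHAR('a::field) = 0 \<or> m < CHAR('a)"
  shows "of_nat (fact m) \<noteq> (0 :: 'a)"
proof
  assume "of_nat (fact m) = (0 :: 'a)"
  then have dvd: "CHAR('a) dvd fact m" by (simp add: of_nat_eq_0_iff_char_dvd)
  then have "CHAR('a) > 0" by (intro Nat.gr0I) auto
  then have "prime CHAR('a)" by (rule prime_CHAR_semidom)
  then have "CHAR('a) \<le> m" using dvd by (simp add: prime_dvd_fact_iff)
  with assms \<open>CHAR('a) > 0\<close> show False by simp
qed

text \<open>
In characteristic \<open>p\<close> with \<open>h * k \<ge> p\<close> the target is lowered to \<open>m = p - 1\<close>, the largest value
whose factorial is nonzero.
\<close>
lemma dias_da_silva_hamidoune: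
  fixes A :: "'a::field set"
  assumes "finite A" "card A = h + k"
  shows "h * k + 1 \<le> card (restricted_sumset h A) \<or>
         0 < CHAR('a) \<and> CHAR('a) \<le> card (restricted_sumset h A)"
proof (cases "CHAR('a) = 0 \<or> h * k < CHAR('a)")
  case True
  then show ?thesis
    using card_restricted_sumset_gt[OF assms order.refl of_nat_fact_nonzero] by simp
next
  case False
  then have "CHAR('a) - 1 < card (restricted_sumset h A)"
    by (intro card_restricted_sumset_gt[OF assms] of_nat_fact_nonzero) auto
  then show ?thesis using False by auto
qed

section \<open>From restricted sums to signed sums\<close>

text \<open>
The prime field is a nontrivial subgroup with \<open>p\<close> elements; so a cardinality that reaches the
characteristic also reaches the smallest subgroup order.
\<close>
lemma min_subgroup_order_le_CHAR:
  assumes "0 < CHAR('a::field)"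
  shows "min_subgroup_order TYPE('a) \<le> enat CHAR('a)"
proof -
  let ?p = "CHAR('a)"
  let ?H = "of_nat ` {..<?p} :: 'a set"
  have H: "?H = range of_nat"
  proof
    show "range of_nat \<subseteq> ?H"
    proof
      fix x :: 'a assume "x \<in> range of_nat"
      then obtain n where "x = of_nat n" by auto
      also have "of_nat n = (of_nat (?p * (n div ?p) + n mod ?p) :: 'a)" by simp
      also have "\<dots> = of_nat (n mod ?p)" by (simp only: of_nat_add of_nat_mult) simp
      finally show "x \<in> ?H" using assms by auto
    qed
  qed auto
  have neg: "- of_nat n = (of_nat (n * (?p - 1)) :: 'a)" for n
  proof -
    have "of_nat n + of_nat (n * (?p - 1)) = (of_nat (n * ?p) :: 'a)"
      using assms by (metis Suc_diff_1 mult_Suc_right of_nat_add)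
    also have "\<dots> = 0" by simp
    finally show ?thesis by (simp only: neg_eq_iff_add_eq_0)
  qed
  have "additive_subgroup_of_type ?H"
    unfolding additive_subgroup_of_type_def H
    by (auto simp flip: of_nat_add of_nat_mult simp: neg intro: range_eqI[of _ _ 0])
  moreover have "1 \<in> ?H" unfolding H by (metis of_nat_1 rangeI)
  then have "?H \<noteq> {0}" by (metis one_neq_zero singletonD)
  ultimately have "min_subgroup_order TYPE('a) \<le> enat (card ?H)"
    unfolding min_subgroup_order_def by (intro INF_lower) auto
  also have "\<dots> \<le> enat ?p" using card_image_le[of "{..<?p}" "of_nat :: nat \<Rightarrow> 'a"] by simp
  finally show ?thesis .
qed

text \<open>
An element of \<open>S\<close> that lies in both \<open>A\<close> and \<open>-A\<close> has two representations; it is always counted as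
\<open>+ a\<close> with \<open>a \<in> A\<close>, so a coefficient \<open>-1\<close> arises only from elements outside \<open>A\<close>. This rule also
covers characteristic \<open>2\<close>, where \<open>a = -a\<close>.
\<close>
lemma restricted_sumset_symmetrization_subset:
  fixes A :: "'a::ring_1 set"
  assumes fin: "finite A"
  shows "restricted_sumset h (insert 0 (A \<union> uminus ` A)) \<subseteq> restricted_signed_sumset_upto h A"
proof
  fix s assume "s \<in> restricted_sumset h (insert 0 (A \<union> uminus ` A))"
  then obtain S where s: "s = \<Sum>S" and S: "S \<subseteq> insert 0 (A \<union> uminus ` A)" "card S = h"
    by (auto simp: restricted_sumset_def)
  have finS: "finite S" using S(1) fin by (auto intro: finite_subset)
  define P where "P = {a \<in> A. a \<in> S}"
  define N where "N = {a \<in> A. - a \<in> S - A}"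
  define c :: "'a \<Rightarrow> int" where "c a = of_bool (a \<in> P) - of_bool (a \<in> N)" for a
  have PN: "finite P" "finite N" "P \<subseteq> A" "N \<subseteq> A" using fin by (auto simp: P_def N_def)
  have disj: "P \<inter> uminus ` N = {}" by (auto simp: P_def N_def)
  have sub: "P \<union> uminus ` N \<subseteq> S" by (auto simp: P_def N_def)
  have inj: "inj_on uminus N" by (auto simp: inj_on_def)
  have "(\<Sum>a\<in>A. of_int (c a) * a) =
      (\<Sum>a\<in>A. if a \<in> P then a else 0) - (\<Sum>a\<in>A. if a \<in> N then a else 0)"
    unfolding sum_subtractf[symmetric] by (rule sum.cong) (auto simp: c_def)
  also have "\<dots> = \<Sum>P - \<Sum>N"
    using PN fin by (simp add: sum.If_cases Int_absorb1)
  also have "\<dots> = \<Sum>P + \<Sum>(uminus ` N)"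
    using inj by (simp add: sum.reindex sum_negf)
  also have "\<dots> = \<Sum>(P \<union> uminus ` N)"
    using PN disj by (simp add: sum.union_disjoint)
  also have "\<dots> = \<Sum>S"
    using finS sub S(1) by (intro sum.mono_neutral_left) (auto simp: P_def N_def)
  finally have s_eq: "s = (\<Sum>a\<in>A. of_int (c a) * a)" using s by simp
  have "(\<Sum>a\<in>A. \<bar>c a\<bar>) \<le> (\<Sum>a\<in>A. of_bool (a \<in> P) + of_bool (a \<in> N))"
    by (rule sum_mono) (auto simp: c_def)
  also have "\<dots> = int (card P) + int (card N)"
    using PN fin by (simp add: sum.distrib Int_absorb1 of_bool_def sum.If_cases)
  also have "\<dots> = int (card (P \<union> uminus ` N))"
    using PN disj inj by (simp add: card_Un_disjoint card_image)
  also have "\<dots> \<le> int h" using card_mono[OF finS sub] S(2) by simp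
  finally have "nat (\<Sum>a\<in>A. \<bar>c a\<bar>) \<le> h" by simp
  moreover have "s \<in> restricted_signed_sumset (nat (\<Sum>a\<in>A. \<bar>c a\<bar>)) A"
    unfolding restricted_signed_sumset_def s_eq
    by (auto intro!: exI[of _ c] simp: c_def sum_nonneg)
  ultimately show "s \<in> restricted_signed_sumset_upto h A"
    unfolding restricted_signed_sumset_upto_def by auto
qed

lemma finite_restricted_signed_sumset_upto:
  fixes A :: "'a::ring_1 set"
  assumes "finite A"
  shows "finite (restricted_signed_sumset_upto h A)"
proof -
  let ?F = "PiE A (\<lambda>_. {-1, 0, 1 :: int})"
  have "restricted_signed_sumset_upto h A \<subseteq> (\<lambda>c. \<Sum>a\<in>A. of_int (c a) * a) ` ?F"
  proof
    fix s assume "s \<in> restricted_signed_sumset_upto h A"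
    then obtain c :: "'a \<Rightarrow> int" where c: "s = (\<Sum>a\<in>A. of_int (c a) * a)"
        "\<forall>a\<in>A. c a \<in> {-1, 0, 1}"
      by (auto simp: restricted_signed_sumset_upto_def restricted_signed_sumset_def)
    then show "s \<in> (\<lambda>c. \<Sum>a\<in>A. of_int (c a) * a) ` ?F"
      by (intro image_eqI[of _ _ "restrict c A"]) auto
  qed
  moreover have "finite ?F" using assms by (intro finite_PiE) auto
  ultimately show ?thesis by (meson finite_imageI finite_subset)
qed

theorem theorem4p7:
  fixes A :: "'a::field set" and h m :: nat
  assumes "h > 0" and "m > 0" and "h \<le> m"
    and "finite A" and "A \<noteq> {}" and "card A = m"
  shows "ereal (real (card (restricted_signed_sumset_upto h A))) \<ge>
    (if 0 \<in> A
     then min (ereal_of_enat (min_subgroup_order TYPE('a)))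
            (ereal (2 * real h * real m - (real h)^2
                    - real h * real (card (A \<inter> uminus ` A)) + 1))
     else min (ereal_of_enat (min_subgroup_order TYPE('a)))
            (ereal (2 * real h * real m - (real h)^2
                    - real h * real (card (A \<inter> uminus ` A)) + real h + 1)))"
proof -
  define B where "B = insert 0 (A \<union> uminus ` A)"
  have finB: "finite B" using assms by (simp add: B_def)
  have "card A \<le> card B" using finB by (intro card_mono) (auto simp: B_def)
  then obtain k where k: "card B = h + k"
    using assms by (metis le_iff_add le_trans)
  have "card (A \<union> uminus ` A) + card (A \<inter> uminus ` A) = 2 * m"
    using card_Un_Int[of A "uminus ` A"] assms by (simp add: card_image)
  moreover have "card B = card (A \<union> uminus ` A) + (if 0 \<in> A then 0 else 1)"
    using assms by (auto simp: B_def insert_absorb card_insert_if)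
  ultimately have "real h + real k = 2 * real m - real (card (A \<inter> uminus ` A)) + (if 0 \<in> A then 0 else 1)"
    using k by (auto split: if_splits)
  then have k_eq: "real k = 2 * real m - real h - real (card (A \<inter> uminus ` A)) + (if 0 \<in> A then 0 else 1)"
    by linarith
  then have bound: "real (h * k + 1) = 2 * real h * real m - (real h)^2
      - real h * real (card (A \<inter> uminus ` A)) + (if 0 \<in> A then 0 else real h) + 1"
    by (cases "0 \<in> A") (simp_all add: k_eq algebra_simps power2_eq_square)
  let ?R = "restricted_signed_sumset_upto h A"
  have le: "card (restricted_sumset h B) \<le> card ?R"
    unfolding B_def using assms
    by (intro card_mono finite_restricted_signed_sumset_upto restricted_sumset_symmetrization_subset)
  have "min (ereal_of_enat (min_subgroup_order TYPE('a))) (ereal (real (h * k + 1))) \<le> ereal (real (card ?R))"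
    using dias_da_silva_hamidoune[OF finB k]
  proof
    assume "h * k + 1 \<le> card (restricted_sumset h B)"
    then have "ereal (real (h * k + 1)) \<le> ereal (real (card ?R))"
      using le by (simp del: of_nat_add of_nat_mult)
    then show ?thesis by (rule min.coboundedI2)
  next
    assume p: "0 < CHAR('a) \<and> CHAR('a) \<le> card (restricted_sumset h B)"
    then have "min_subgroup_order TYPE('a) \<le> enat (card ?R)"
      using min_subgroup_order_le_CHAR[where 'a = 'a] le by (meson enat_ord_simps(1) order_trans)
    then have "ereal_of_enat (min_subgroup_order TYPE('a)) \<le> ereal_of_enat (enat (card ?R))"
      by (simp only: ereal_of_enat_le_iff)
    then show ?thesis by (intro min.coboundedI1) simp
  qed
  then show ?thesis unfolding bound by (cases "0 \<in> A") simp_all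
qed

end
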